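(* There is an absolute constant $c>0$ such that for all sufficiently large $n$, there are at least $2^{c n\log n}$ unlabelled (i.e., pairwise non-isomorphic) bipartite graphs on $n$ vertices that are intersection graphs of straight-line segments in the plane.
   Context: The intersection graph of a collection of sets has the members of the collection as vertices, two of them being adjacent if and only if they have nonempty intersection. *)

theory Defs
  imports
    "HOL-Analysis.Analysis"
    "Graph_Theory.Pair_Digraph"
    "Graph_Theory.Digraph_Isomorphism"
begin

text \<open>
  Finite simple graphs are the \<^locale>\<open>pair_graph\<close>s of the library: an undirected edge is a
  pair of opposite arcs, and there are no loops.
\<close>

definition intersection_graph :: "'a set set \<Rightarrow> 'a set pair_pre_digraph" where
  "intersection_graph S =
     \<lparr> pverts = S, parcs = {(A, B). A \<in> S \<and> B \<in> S \<and> A \<noteq> B \<and> A \<inter> B \<noteq> {}} \<rparr>"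

lemma pair_graph_intersection_graph:
  assumes "finite S"
  shows "pair_graph (intersection_graph S)"
proof -
  have "finite {(A, B). A \<in> S \<and> B \<in> S \<and> A \<noteq> B \<and> A \<inter> B \<noteq> {}}"
    by (rule finite_subset[of _ "S \<times> S"]) (use assms in auto)
  then show ?thesis
    using assms
    by unfold_locales
      (auto simp: intersection_graph_def symmetric_def sym_def arcs_ends_conv)
qed

definition straight_segment :: "(real ^ 2) set \<Rightarrow> bool" where
  "straight_segment s \<longleftrightarrow> (\<exists>a b. a \<noteq> b \<and> s = closed_segment a b)"

definition segment_graph :: "(real ^ 2) set pair_pre_digraph \<Rightarrow> bool" where
  "segment_graph G \<longleftrightarrow>
     (\<exists>S. finite S \<and> (\<forall>s\<in>S. straight_segment s) \<and> G = intersection_graph S)"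

definition bipartite :: "'a pair_pre_digraph \<Rightarrow> bool" where
  "bipartite G \<longleftrightarrow>
     (\<exists>A B. pverts G = A \<union> B \<and> A \<inter> B = {} \<and> parcs G \<subseteq> A \<times> B \<union> B \<times> A)"

definition isomorphic :: "'a pair_pre_digraph \<Rightarrow> 'b pair_pre_digraph \<Rightarrow> bool" where
  "isomorphic G H \<longleftrightarrow> digraph_iso (with_proj G) (with_proj H)"

text \<open>
  Heads and tails of pair graphs are the projections, so the arc map of a library isomorphism is
  determined by its vertex map.
\<close>

lemma isomorphic_iff:
  assumes "pair_graph G" "pair_graph H"
  shows "isomorphic G H \<longleftrightarrow>
    (\<exists>f. bij_betw f (pverts G) (pverts H) \<and>
         (\<forall>u\<in>pverts G. \<forall>v\<in>pverts G. (u, v) \<in> parcs G \<longleftrightarrow> (f u, f v) \<in> parcs H))"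
    (is "_ \<longleftrightarrow> (\<exists>f. ?P f)")
proof
  interpret G: pair_graph G by fact
  interpret H: pair_graph H by fact
  show "\<exists>f. ?P f" if iso: "isomorphic G H"
  proof -
    obtain h where h: "pre_digraph.digraph_isomorphism (with_proj G) h"
      and H: "with_proj H = app_iso h (with_proj G)"
      using iso by (auto simp: isomorphic_def digraph_iso_def)
    have verts: "pverts H = iso_verts h ` pverts G"
      and arcs: "parcs H = iso_arcs h ` parcs G"
      and tail: "iso_tail h = fst" and head: "iso_head h = snd"
      using arg_cong[OF H, of verts] arg_cong[OF H, of arcs]
        arg_cong[OF H, of tail] arg_cong[OF H, of head] by auto
    have inj: "inj_on (iso_verts h) (pverts G)"
      using h by (auto simp: pre_digraph.digraph_isomorphism_def)
    have arc: "iso_arcs h (u, v) = (iso_verts h u, iso_verts h v)" if "(u, v) \<in> parcs G" for u v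
      using h that by (auto simp: pre_digraph.digraph_isomorphism_def tail head prod_eq_iff)
    have "(u, v) \<in> parcs G"
      if uv: "u \<in> pverts G" "v \<in> pverts G" and uvH: "(iso_verts h u, iso_verts h v) \<in> parcs H" for u v
    proof -
      obtain e where e: "e \<in> parcs G" and "iso_arcs h e = (iso_verts h u, iso_verts h v)"
        using uvH unfolding arcs by auto
      then have "iso_verts h (fst e) = iso_verts h u" "iso_verts h (snd e) = iso_verts h v"
        using arc[of "fst e" "snd e"] by auto
      moreover have "fst e \<in> pverts G" "snd e \<in> pverts G"
        using e by (auto intro: G.arc_fst_in_verts G.arc_snd_in_verts)
      ultimately have "fst e = u" "snd e = v"
        using inj uv by (auto dest: inj_onD)
      then show ?thesis using e by auto
    qed
    then have "?P (iso_verts h)"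
      using inj arc by (auto simp: bij_betw_def verts arcs intro: rev_image_eqI)
    then show ?thesis by blast
  qed
  show "isomorphic G H" if ex: "\<exists>f. ?P f"
  proof -
    obtain f where f: "?P f" using ex by blast
    define h where "h = \<lparr> iso_verts = f, iso_arcs = map_prod f f,
      iso_head = (snd :: 'b \<times> 'b \<Rightarrow> 'b), iso_tail = fst \<rparr>"
    have inG: "u \<in> pverts G \<and> v \<in> pverts G" if "(u, v) \<in> parcs G" for u v
      using G.arc_fst_in_verts[OF that] G.arc_snd_in_verts[OF that] by simp
    have inH: "u \<in> pverts H \<and> v \<in> pverts H" if "(u, v) \<in> parcs H" for u v
      using H.arc_fst_in_verts[OF that] H.arc_snd_in_verts[OF that] by simp
    have inj: "inj_on f (pverts G)" and im: "f ` pverts G = pverts H"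
      using f by (auto simp: bij_betw_def)
    have "inj_on (map_prod f f) (parcs G)"
      by (rule inj_on_subset[OF map_prod_inj_on[OF inj inj]]) (use inG in auto)
    moreover have "map_prod f f ` parcs G = parcs H"
    proof
      show "map_prod f f ` parcs G \<subseteq> parcs H" using f inG by auto
      show "parcs H \<subseteq> map_prod f f ` parcs G"
      proof
        fix e assume e: "e \<in> parcs H"
        obtain x y where xy: "e = (x, y)" by (cases e)
        obtain u v where "u \<in> pverts G" "v \<in> pverts G" "x = f u" "y = f v"
          using inH[of x y] e xy im by (metis imageE)
        then show "e \<in> map_prod f f ` parcs G"
          using f e xy by (auto intro: rev_image_eqI)
      qed
    qed
    ultimately have "pre_digraph.digraph_isomorphism (with_proj G) h"
      and "with_proj H = app_iso h (with_proj G)"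
      using inj im G.wf_digraph
      by (auto simp: pre_digraph.digraph_isomorphism_def h_def app_iso_def with_proj_def)
    then show ?thesis by (auto simp: isomorphic_def digraph_iso_def)
  qed
qed

end

theory Submission
  imports Defs
begin

text \<open>
  The graphs are drawn with horizontal and vertical segments only, and each carries an arbitrary
  function \<open>g\<close> from \<open>{1..k}\<close> to \<open>{1..k}\<close> that can be read off from the isomorphism class. With
  \<open>k\<close> about \<open>n / 6\<close> this gives \<open>k ^ k\<close> graphs, which is \<open>2 powr (c * n * log 2 n)\<close> or more.

  Take long horizontal segments at the heights \<open>0, \<dots>, 2 * k\<close>. The code is written by \<open>k\<close> vertical
  segments, the \<open>i\<close>-th of which crosses exactly the horizontals \<open>i, \<dots>, k + g i\<close>. If the horizontals
  are known individually, then so is \<open>g\<close>: the lowest horizontal crossed by a code segment tells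
  which \<open>i\<close> it belongs to, and the highest one tells \<open>g i\<close>.

  To make the horizontals recognisable in the abstract graph, add \<open>L + 1\<close> further verticals, the
  anchors, where the anchor \<open>j\<close> crosses the horizontals \<open>0, \<dots>, j\<close> and \<open>L > 2 * k\<close>. The anchor \<open>0\<close> is
  then the only vertex of degree one (lemma \<open>unique_leaf\<close>), its neighbour is the horizontal \<open>0\<close>, and
  the neighbours of the latter are precisely the anchors. So every isomorphism preserves the set of
  anchors, and the horizontal \<open>i\<close> is recognised by having exactly \<open>L + 1 - i\<close> anchors as neighbours.
  Hence isomorphic graphs have the same code (lemma \<open>code_determined_by_isomorphism_class\<close>). There
  are \<open>L + 3 * k + 2\<close> vertices, and the freedom in \<open>L\<close> makes every large \<open>n\<close> attainable.
\<close>

section \<open>The graphs as incidence structures\<close>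

text \<open>
  The verticals \<open>j \<le> L\<close> are the anchors and the vertical \<open>L + i\<close> with \<open>1 \<le> i \<le> k\<close> carries the value
  \<open>g i\<close>. An anchor \<open>j\<close> beyond \<open>2 * k\<close> reaches heights at which there is no horizontal.
\<close>

definition reach :: "nat \<Rightarrow> nat \<Rightarrow> (nat \<Rightarrow> nat) \<Rightarrow> nat \<Rightarrow> nat set" where
  "reach L k g j = (if j \<le> L then {..j} else {j - L..k + g (j - L)})"

text \<open>
  Horizontals are tagged with \<^const>\<open>Inl\<close> and verticals with \<^const>\<open>Inr\<close>. The vertex set is the same
  for all codes, so isomorphisms can be studied as permutations of it.
\<close>

definition lines :: "nat \<Rightarrow> nat \<Rightarrow> (nat + nat) set" where
  "lines L k = {..2 * k} <+> {..L + k}"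

fun crosses :: "nat \<Rightarrow> nat \<Rightarrow> (nat \<Rightarrow> nat) \<Rightarrow> nat + nat \<Rightarrow> nat + nat \<Rightarrow> bool" where
  "crosses L k g (Inl i) (Inr j) \<longleftrightarrow> i \<in> reach L k g j"
| "crosses L k g (Inr j) (Inl i) \<longleftrightarrow> i \<in> reach L k g j"
| "crosses L k g _ _ \<longleftrightarrow> False"

abbreviation codes :: "nat \<Rightarrow> (nat \<Rightarrow> nat) set" where
  "codes k \<equiv> {1..k} \<rightarrow>\<^sub>E {1..k}"

definition nbrs :: "nat \<Rightarrow> nat \<Rightarrow> (nat \<Rightarrow> nat) \<Rightarrow> nat + nat \<Rightarrow> (nat + nat) set" where
  "nbrs L k g v = {w \<in> lines L k. crosses L k g v w}"

lemma finite_lines: "finite (lines L k)"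
  by (simp add: lines_def)

lemma card_lines: "card (lines L k) = L + 3 * k + 2"
  by (simp add: lines_def card_Plus)

lemma code_le: "g \<in> codes k \<Longrightarrow> 1 \<le> i \<Longrightarrow> i \<le> k \<Longrightarrow> 1 \<le> g i \<and> g i \<le> k"
  by (auto simp: PiE_iff)

lemma nbrs_Inr:
  assumes "j \<le> L + k"
  shows "nbrs L k g (Inr j) = Inl ` (reach L k g j \<inter> {..2 * k})"
  by (auto simp: nbrs_def lines_def elim: crosses.elims)

lemma nbrs_Inl:
  "nbrs L k g (Inl i) = Inr ` {j. j \<le> L + k \<and> i \<in> reach L k g j}"
  by (auto simp: nbrs_def lines_def elim: crosses.elims)

lemma nbrs_anchor: "j \<le> L \<Longrightarrow> nbrs L k g (Inr j) = Inl ` {..min j (2 * k)}"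
  by (auto simp: nbrs_Inr reach_def)

lemma nbrs_code:
  assumes "1 \<le> i" "i \<le> k" "g \<in> codes k"
  shows "nbrs L k g (Inr (L + i)) = Inl ` {i..k + g i}"
  using assms code_le[OF assms(3,1,2)] by (auto simp: nbrs_Inr reach_def)

lemma nbrs_root: "nbrs L k g (Inl 0) = Inr ` {..L}"
  by (auto simp: nbrs_Inl reach_def)

text \<open>
  The anchors meet the horizontals in a half graph, so the size of this set determines \<open>i\<close>.
\<close>

lemma nbrs_horizontal_anchor: "nbrs L k g (Inl i) \<inter> Inr ` {..L} = Inr ` {i..L}"
  by (auto simp: nbrs_Inl reach_def)

text \<open>
  A horizontal \<open>i\<close> meets the last two anchors because \<open>i \<le> 2 * k < L\<close>; a later anchor meets the
  horizontals \<open>0\<close> and \<open>1\<close>; a code segment meets \<open>k\<close> and \<open>k + g i\<close>, and \<open>g i\<close> is positive.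
\<close>

lemma unique_leaf:
  assumes L: "2 * k < L" and k: "1 \<le> k" and g: "g \<in> codes k"
    and v: "v \<in> lines L k" and leaf: "nbrs L k g v = {u}"
  shows "v = Inr 0 \<and> u = Inl 0"
proof (cases v)
  case (Inl i)
  then have "i \<le> 2 * k" using v by (auto simp: lines_def)
  then have "Inr L \<in> nbrs L k g v" "Inr (L - 1) \<in> nbrs L k g v"
    using L Inl by (auto simp: nbrs_Inl reach_def)
  then have "(Inr L :: nat + nat) = Inr (L - 1)" unfolding leaf by (metis singletonD)
  then show ?thesis using L by simp
next
  case (Inr j)
  then have j: "j \<le> L + k" using v by (auto simp: lines_def)
  consider "j = 0" | "1 \<le> j" "j \<le> L" | i where "j = L + i" "1 \<le> i" "i \<le> k"
  proof -
    show thesis if *: "j = 0 \<Longrightarrow> thesis" "1 \<le> j \<Longrightarrow> j \<le> L \<Longrightarrow> thesis"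
      "\<And>i. j = L + i \<Longrightarrow> 1 \<le> i \<Longrightarrow> i \<le> k \<Longrightarrow> thesis"
      using *(1,2) *(3)[of "j - L"] j by linarith
  qed
  then show ?thesis
  proof cases
    case 1
    then show ?thesis using leaf Inr g by (auto simp: nbrs_anchor)
  next
    case 2
    then have "Inl 0 \<in> nbrs L k g v" "Inl 1 \<in> nbrs L k g v"
      using Inr g k by (auto simp: nbrs_anchor)
    then show ?thesis using leaf by auto
  next
    case 3
    then have "Inl k \<in> nbrs L k g v" "Inl (k + g i) \<in> nbrs L k g v" "g i \<noteq> 0"
      using Inr g code_le[OF g 3(2,3)] by (auto simp: nbrs_code)
    moreover from this have "(Inl k :: nat + nat) = Inl (k + g i)"
      unfolding leaf by (metis singletonD)
    ultimately show ?thesis by simp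
  qed
qed

lemma iso_nbrs:
  assumes "bij_betw f (lines L k) (lines L k)"
    and "\<And>u v. u \<in> lines L k \<Longrightarrow> v \<in> lines L k \<Longrightarrow>
      crosses L k g u v \<longleftrightarrow> crosses L k g' (f u) (f v)"
    and "v \<in> lines L k"
  shows "f ` nbrs L k g v = nbrs L k g' (f v)"
proof
  show "f ` nbrs L k g v \<subseteq> nbrs L k g' (f v)"
    using assms unfolding nbrs_def bij_betw_def by blast
  show "nbrs L k g' (f v) \<subseteq> f ` nbrs L k g v"
  proof
    fix w assume w: "w \<in> nbrs L k g' (f v)"
    then obtain u where "u \<in> lines L k" "w = f u"
      using assms(1) by (auto simp: nbrs_def bij_betw_def)
    then show "w \<in> f ` nbrs L k g v" using w assms(2,3) by (auto simp: nbrs_def)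
  qed
qed

text \<open>
  The isomorphism \<open>f\<close> fixes the horizontal \<open>0\<close>, by uniqueness of the leaf. Therefore it permutes the
  anchors, then it fixes every horizontal, and finally it preserves the neighbourhood of every code
  segment, which is the interval that encodes a value of \<open>g\<close>.
\<close>

lemma code_determined_by_isomorphism_class:
  assumes L: "2 * k < L" and k: "1 \<le> k" and g: "g \<in> codes k" and g': "g' \<in> codes k"
    and f: "bij_betw f (lines L k) (lines L k)"
    and iso: "\<And>u v. u \<in> lines L k \<Longrightarrow> v \<in> lines L k \<Longrightarrow>
      crosses L k g u v \<longleftrightarrow> crosses L k g' (f u) (f v)"
  shows "g = g'"
proof -
  note N = iso_nbrs[OF f iso]
  have inj: "inj_on f (lines L k)" and maps: "\<And>v. v \<in> lines L k \<Longrightarrow> f v \<in> lines L k"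
    using f by (auto simp: bij_betw_def)
  have H: "Inl i \<in> lines L k \<longleftrightarrow> i \<le> 2 * k" and V: "Inr i \<in> lines L k \<longleftrightarrow> i \<le> L + k" for i
    by (auto simp: lines_def)
  have "nbrs L k g' (f (Inr 0)) = {f (Inl 0)}"
    using N[of "Inr 0"] g by (simp add: nbrs_anchor V)
  from unique_leaf[OF L k g' maps this] have root: "f (Inl 0) = Inl 0"
    by (simp add: V)
  have anchors: "f ` Inr ` {..L} = Inr ` {..L}"
    using N[of "Inl 0"] by (simp add: root nbrs_root H)
  have fixed: "f (Inl i) = Inl i" if i: "i \<le> 2 * k" for i
  proof -
    \<comment> \<open>The anchor \<open>L\<close> meets all horizontals, which forces the image of a horizontal to be horizontal.\<close>
    obtain j where j: "f (Inr L) = Inr j" using anchors by blast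
    have "crosses L k g (Inl i) (Inr L)" using i L by (simp add: reach_def)
    then have "crosses L k g' (f (Inl i)) (Inr j)"
      using iso[of "Inl i" "Inr L"] i by (simp add: H V j)
    then obtain i' where i': "f (Inl i) = Inl i'" by (cases "f (Inl i)") auto
    have "i' \<le> 2 * k" using maps[of "Inl i"] i i' by (simp add: H)
    \<comment> \<open>Compare the numbers of neighbouring anchors.\<close>
    have "f ` Inr ` {i..L} = f ` (nbrs L k g (Inl i) \<inter> Inr ` {..L})"
      by (simp add: nbrs_horizontal_anchor)
    also have "\<dots> = f ` nbrs L k g (Inl i) \<inter> f ` Inr ` {..L}"
      by (rule inj_on_image_Int[OF inj]) (auto simp: nbrs_def V)
    also have "\<dots> = Inr ` {i'..L}"
      using N[of "Inl i"] i by (simp add: H i' anchors nbrs_horizontal_anchor)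
    finally have "card (f ` Inr ` {i..L}) = card (Inr ` {i'..L} :: (nat + nat) set)" by simp
    moreover have "inj_on f (Inr ` {i..L})"
      by (rule inj_on_subset[OF inj]) (auto simp: V)
    ultimately have "Suc L - i = Suc L - i'" by (simp add: card_image)
    then show ?thesis using i' i \<open>i' \<le> 2 * k\<close> L by simp
  qed
  have "g i = g' i" if i: "1 \<le> i" "i \<le> k" for i
  proof -
    have gi: "1 \<le> g i" "g i \<le> k" using code_le[OF g i] by auto
    have "nbrs L k g' (f (Inr (L + i))) = f ` Inl ` {i..k + g i}"
      using N[of "Inr (L + i)"] i by (simp add: V nbrs_code[OF i g])
    also have "\<dots> = Inl ` {i..k + g i}"
      using gi fixed by (force simp: image_image intro!: image_cong)
    finally have E: "nbrs L k g' (f (Inr (L + i))) = Inl ` {i..k + g i}" .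
    have "Inl i \<in> nbrs L k g' (f (Inr (L + i)))" unfolding E using i by simp
    then obtain j where j: "f (Inr (L + i)) = Inr j"
      by (cases "f (Inr (L + i))") (auto simp: nbrs_def)
    have "j \<le> L + k" using maps[of "Inr (L + i)"] i by (simp add: V j)
    \<comment> \<open>A code segment misses the horizontal \<open>0\<close>, so its image is not an anchor.\<close>
    moreover have "L < j"
    proof (rule ccontr)
      assume "\<not> L < j"
      then have "Inl 0 \<in> nbrs L k g' (Inr j)" using g' by (simp add: nbrs_anchor)
      then show False using E j i by auto
    qed
    ultimately have "j = L + (j - L)" "1 \<le> j - L" "j - L \<le> k" by linarith+
    then obtain i' where i': "j = L + i'" "1 \<le> i'" "i' \<le> k" by blast
    have "Inl ` {i'..k + g' i'} = (Inl ` {i..k + g i} :: (nat + nat) set)"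
      using E nbrs_code[OF i'(2,3) g', of L] by (simp add: j i')
    then have "{i'..k + g' i'} = {i..k + g i}" by (simp add: inj_image_eq_iff)
    then show ?thesis using i i' gi by auto
  qed
  then show ?thesis using g g' by (intro PiE_ext[OF g g']) auto
qed

section \<open>Realisation by segments\<close>

definition horizontal :: "real \<Rightarrow> real \<Rightarrow> (real ^ 2) set" where
  "horizontal X y = closed_segment (vector [0, y]) (vector [X, y])"

definition vertical :: "real \<Rightarrow> real \<Rightarrow> real \<Rightarrow> (real ^ 2) set" where
  "vertical x a b = closed_segment (vector [x, a]) (vector [x, b])"

lemma mem_horizontal:
  assumes "0 < X"
  shows "p \<in> horizontal X y \<longleftrightarrow> p $ 2 = y \<and> 0 \<le> p $ 1 \<and> p $ 1 \<le> X"
proof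
  assume "p \<in> horizontal X y"
  then obtain u where u: "0 \<le> u" "u \<le> 1"
    and p: "p = (1 - u) *\<^sub>R vector [0, y] + u *\<^sub>R vector [X, y]"
    by (auto simp: horizontal_def in_segment)
  have "p $ 1 = u * X" "p $ 2 = y" by (auto simp: p algebra_simps)
  moreover have "0 \<le> u * X" "u * X \<le> X"
    using u assms by (auto simp: mult_left_le_one_le)
  ultimately show "p $ 2 = y \<and> 0 \<le> p $ 1 \<and> p $ 1 \<le> X" by simp
next
  assume p: "p $ 2 = y \<and> 0 \<le> p $ 1 \<and> p $ 1 \<le> X"
  define u where "u = p $ 1 / X"
  have u: "0 \<le> u" "u \<le> 1" "u * X = p $ 1" using p assms by (auto simp: u_def)
  have "p = (1 - u) *\<^sub>R vector [0, y] + u *\<^sub>R vector [X, y]"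
    unfolding vec_eq_iff forall_2 using p u(3) by (simp add: algebra_simps)
  with u show "p \<in> horizontal X y" unfolding horizontal_def in_segment by blast
qed

lemma mem_vertical:
  assumes "a < b"
  shows "p \<in> vertical x a b \<longleftrightarrow> p $ 1 = x \<and> a \<le> p $ 2 \<and> p $ 2 \<le> b"
proof
  assume "p \<in> vertical x a b"
  then obtain u where u: "0 \<le> u" "u \<le> 1"
    and p: "p = (1 - u) *\<^sub>R vector [x, a] + u *\<^sub>R vector [x, b]"
    by (auto simp: vertical_def in_segment)
  have "p $ 1 = x" "p $ 2 = a + u * (b - a)" by (auto simp: p algebra_simps)
  moreover have "0 \<le> u * (b - a)" "u * (b - a) \<le> b - a"
    using u assms by (auto simp: mult_left_le_one_le)
  ultimately show "p $ 1 = x \<and> a \<le> p $ 2 \<and> p $ 2 \<le> b" by simp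
next
  assume p: "p $ 1 = x \<and> a \<le> p $ 2 \<and> p $ 2 \<le> b"
  define u where "u = (p $ 2 - a) / (b - a)"
  have u: "0 \<le> u" "u \<le> 1" "u * (b - a) = p $ 2 - a" using p assms by (auto simp: u_def)
  have "p = (1 - u) *\<^sub>R vector [x, a] + u *\<^sub>R vector [x, b]"
    unfolding vec_eq_iff forall_2 using p u(3) by (simp add: algebra_simps)
  with u show "p \<in> vertical x a b" unfolding vertical_def in_segment by blast
qed

text \<open>
  The lower end \<open>-1\<close> of the anchors keeps the segment of the anchor \<open>0\<close> from degenerating to a point.
\<close>

fun seg :: "nat \<Rightarrow> nat \<Rightarrow> (nat \<Rightarrow> nat) \<Rightarrow> nat + nat \<Rightarrow> (real ^ 2) set" where
  "seg L k g (Inl i) = horizontal (real (L + k)) (real i)"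
| "seg L k g (Inr j) = vertical (real j)
     (if j \<le> L then -1 else real (j - L)) (real (if j \<le> L then j else k + g (j - L)))"

definition code_graph :: "nat \<Rightarrow> nat \<Rightarrow> (nat \<Rightarrow> nat) \<Rightarrow> (real ^ 2) set pair_pre_digraph" where
  "code_graph L k g = intersection_graph (seg L k g ` lines L k)"

lemma mem_seg_Inl:
  "1 \<le> k \<Longrightarrow> p \<in> seg L k g (Inl i) \<longleftrightarrow> p $ 2 = real i \<and> 0 \<le> p $ 1 \<and> p $ 1 \<le> real (L + k)"
  by (simp add: mem_horizontal)

lemma seg_bounds:
  assumes "g \<in> codes k" "j \<le> L + k"
  shows "(if j \<le> L then -1 else real (j - L)) < real (if j \<le> L then j else k + g (j - L))"
proof (cases "j \<le> L")
  case False
  then have "j - L \<le> k" "1 \<le> g (j - L)"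
    using assms code_le[of g k "j - L"] by auto
  then show ?thesis using False by simp
qed simp

lemma mem_seg_Inr:
  assumes "g \<in> codes k" "j \<le> L + k"
  shows "p \<in> seg L k g (Inr j) \<longleftrightarrow> p $ 1 = real j \<and>
    (if j \<le> L then -1 else real (j - L)) \<le> p $ 2 \<and>
    p $ 2 \<le> real (if j \<le> L then j else k + g (j - L))"
  unfolding seg.simps by (rule mem_vertical[OF seg_bounds[OF assms]])

lemma straight_segment_seg:
  assumes "1 \<le> k" "g \<in> codes k" "v \<in> lines L k"
  shows "straight_segment (seg L k g v)"
proof (cases v)
  case (Inl i)
  have "(vector [0, real i] :: real ^ 2) \<noteq> vector [real (L + k), real i]"
    using assms(1) by (simp add: vec_eq_iff forall_2)
  then show ?thesis unfolding straight_segment_def Inl seg.simps horizontal_def by blast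
next
  case (Inr j)
  then have "j \<le> L + k" using assms(3) by (auto simp: lines_def)
  have "(vector [x, a] :: real ^ 2) \<noteq> vector [x, b]" if "a < b" for x a b :: real
    using that by (simp add: vec_eq_iff forall_2)
  from this[OF seg_bounds[OF assms(2) \<open>j \<le> L + k\<close>]] show ?thesis
    unfolding straight_segment_def Inr seg.simps vertical_def by blast
qed

lemma Inl_Inr_meet:
  assumes "1 \<le> k" "g \<in> codes k" "j \<le> L + k"
  shows "seg L k g (Inl i) \<inter> seg L k g (Inr j) \<noteq> {} \<longleftrightarrow> i \<in> reach L k g j"
proof -
  have "seg L k g (Inl i) \<inter> seg L k g (Inr j) \<noteq> {} \<longleftrightarrow>
      vector [real j, real i] \<in> seg L k g (Inl i) \<inter> seg L k g (Inr j)"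
  proof
    assume "seg L k g (Inl i) \<inter> seg L k g (Inr j) \<noteq> {}"
    then obtain p where p: "p \<in> seg L k g (Inl i)" "p \<in> seg L k g (Inr j)" by blast
    then have "p = vector [real j, real i]"
      using mem_seg_Inl[OF assms(1)] mem_seg_Inr[OF assms(2,3)]
      by (simp add: vec_eq_iff forall_2)
    with p show "vector [real j, real i] \<in> seg L k g (Inl i) \<inter> seg L k g (Inr j)" by simp
  qed blast
  also have "\<dots> \<longleftrightarrow> i \<in> reach L k g j"
    unfolding Int_iff mem_seg_Inl[OF assms(1)] mem_seg_Inr[OF assms(2,3)]
    using assms(3) by (auto simp: reach_def)
  finally show ?thesis .
qed

lemma seg_meet:
  assumes "1 \<le> k" "g \<in> codes k" "u \<in> lines L k" "v \<in> lines L k" "u \<noteq> v"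
  shows "seg L k g u \<inter> seg L k g v \<noteq> {} \<longleftrightarrow> crosses L k g u v"
proof -
  have V: "Inr j \<in> lines L k \<Longrightarrow> j \<le> L + k" for j by (auto simp: lines_def)
  show ?thesis
  proof (cases u)
    case u: (Inl i)
    show ?thesis
    proof (cases v)
      case (Inl i')
      then show ?thesis using u assms(5) mem_seg_Inl[OF assms(1)] by (auto simp del: seg.simps)
    next
      case (Inr j)
      then show ?thesis using u Inl_Inr_meet[OF assms(1,2)] V assms(4) by (simp del: seg.simps)
    qed
  next
    case u: (Inr j)
    show ?thesis
    proof (cases v)
      case (Inl i)
      then show ?thesis using u Inl_Inr_meet[OF assms(1,2)] V assms(3)
        by (simp add: Int_commute del: seg.simps)
    next
      case (Inr j')
      then show ?thesis
        using u assms(3-5) V mem_seg_Inr[OF assms(2)] by (auto simp del: seg.simps)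
    qed
  qed
qed

text \<open>
  The vertices of an intersection graph are the segments themselves, so that the vertex count depends
  on no two of them coinciding. If they do, they meet, and then one is horizontal and the other one
  vertical; but a horizontal segment contains points with different abscissae.
\<close>

lemma inj_seg:
  assumes "1 \<le> k" "g \<in> codes k"
  shows "inj_on (seg L k g) (lines L k)"
proof (rule inj_onI)
  fix u v assume uv: "u \<in> lines L k" "v \<in> lines L k" "seg L k g u = seg L k g v"
  have ne: "seg L k g u \<noteq> {}"
    using straight_segment_seg[OF assms uv(1)] by (auto simp: straight_segment_def)
  have horizontal_ne_vertical: "seg L k g (Inl i) \<noteq> seg L k g (Inr j)"
    if j: "j \<le> L + k" for i j
  proof
    assume eq: "seg L k g (Inl i) = seg L k g (Inr j)"
    have "vector [0, real i] \<in> seg L k g (Inr j)" "vector [real (L + k), real i] \<in> seg L k g (Inr j)"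
      unfolding eq[symmetric] using mem_seg_Inl[OF assms(1)] by (auto simp del: seg.simps)
    then have "0 = real j" "real (L + k) = real j"
      unfolding mem_seg_Inr[OF assms(2) j] by auto
    then show False using assms(1) by simp
  qed
  show "u = v"
  proof (rule ccontr)
    assume "u \<noteq> v"
    then have "crosses L k g u v" using seg_meet[OF assms uv(1,2)] ne uv(3) by simp
    then show False
      using uv horizontal_ne_vertical horizontal_ne_vertical[symmetric]
      by (cases u; cases v) (auto simp: lines_def simp del: seg.simps)
  qed
qed

lemma pverts_code_graph: "pverts (code_graph L k g) = seg L k g ` lines L k"
  by (simp add: code_graph_def intersection_graph_def)

lemma pair_graph_code_graph: "pair_graph (code_graph L k g)"
  by (simp add: code_graph_def pair_graph_intersection_graph finite_lines)

lemma parcs_code_graph: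
  assumes "1 \<le> k" "g \<in> codes k" "u \<in> lines L k" "v \<in> lines L k"
  shows "(seg L k g u, seg L k g v) \<in> parcs (code_graph L k g) \<longleftrightarrow> crosses L k g u v"
proof (cases "u = v")
  case True
  then show ?thesis by (cases v) (simp_all add: code_graph_def intersection_graph_def)
next
  case False
  then show ?thesis
    using seg_meet[OF assms False] inj_onD[OF inj_seg[OF assms(1,2)] _ assms(3,4)] assms(3,4)
    by (auto simp: code_graph_def intersection_graph_def)
qed

lemma code_graph_isomorphic_imp_eq:
  assumes L: "2 * k < L" and k: "1 \<le> k" and g: "g \<in> codes k" and g': "g' \<in> codes k"
    and iso: "isomorphic (code_graph L k g) (code_graph L k g')"
  shows "g = g'"
proof -
  let ?s = "seg L k g" and ?t = "seg L k g'" and ?V = "lines L k"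
  obtain F where F: "bij_betw F (?s ` ?V) (?t ` ?V)"
    and arc: "\<And>u v. u \<in> ?V \<Longrightarrow> v \<in> ?V \<Longrightarrow>
      (?s u, ?s v) \<in> parcs (code_graph L k g) \<longleftrightarrow> (F (?s u), F (?s v)) \<in> parcs (code_graph L k g')"
    using iso unfolding isomorphic_iff[OF pair_graph_code_graph pair_graph_code_graph]
    by (auto simp: pverts_code_graph)
  define f where "f = inv_into ?V ?t \<circ> (F \<circ> ?s)"
  have s: "bij_betw ?s ?V (?s ` ?V)" and t: "bij_betw ?t ?V (?t ` ?V)"
    using inj_seg k g g' by (auto simp: bij_betw_def)
  have f: "bij_betw f ?V ?V"
    unfolding f_def by (intro bij_betw_trans[OF bij_betw_trans[OF s F] bij_betw_inv_into[OF t]])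
  have tf: "?t (f v) = F (?s v)" if "v \<in> ?V" for v
    using that F by (auto simp: f_def bij_betw_def intro!: f_inv_into_f)
  have "crosses L k g u v \<longleftrightarrow> crosses L k g' (f u) (f v)" if uv: "u \<in> ?V" "v \<in> ?V" for u v
  proof -
    have "f u \<in> ?V" "f v \<in> ?V" using f uv by (auto simp: bij_betw_def)
    then show ?thesis
      using arc[OF uv] parcs_code_graph[OF k g uv] parcs_code_graph[OF k g', of "f u" L "f v"] uv
      by (simp add: tf)
  qed
  from code_determined_by_isomorphism_class[OF L k g g' f this] show ?thesis .
qed

lemma isomorphic_refl:
  assumes "pair_graph G"
  shows "isomorphic G G"
  unfolding isomorphic_iff[OF assms assms] by (rule exI[of _ id]) simp

lemma segment_graph_code_graph:
  assumes "1 \<le> k" "g \<in> codes k"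
  shows "segment_graph (code_graph L k g)"
  unfolding segment_graph_def code_graph_def
proof (intro exI conjI ballI)
  show "finite (seg L k g ` lines L k)" by (rule finite_imageI[OF finite_lines])
  show "straight_segment s" if "s \<in> seg L k g ` lines L k" for s
    using that by (rule imageE) (simp only: straight_segment_seg[OF assms])
qed (rule refl)

lemma bipartite_code_graph:
  assumes "1 \<le> k" "g \<in> codes k"
  shows "bipartite (code_graph L k g)"
proof -
  let ?A = "seg L k g ` Inl ` {..2 * k}" and ?B = "seg L k g ` Inr ` {..L + k}"
  have V: "lines L k = Inl ` {..2 * k} \<union> Inr ` {..L + k}" by (auto simp: lines_def)
  have "?A \<inter> ?B = seg L k g ` (Inl ` {..2 * k} \<inter> Inr ` {..L + k})"
    by (rule inj_on_image_Int[OF inj_seg[OF assms], symmetric]) (auto simp: lines_def)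
  also have "\<dots> = {}" by auto
  finally have disj: "?A \<inter> ?B = {}" .
  have "e \<in> ?A \<times> ?B \<union> ?B \<times> ?A" if e: "e \<in> parcs (code_graph L k g)" for e
  proof -
    obtain u v where uv: "u \<in> lines L k" "v \<in> lines L k" "e = (seg L k g u, seg L k g v)"
      using e by (auto simp: code_graph_def intersection_graph_def)
    then have "crosses L k g u v" using e parcs_code_graph[OF assms] by blast
    then show ?thesis using uv
      by (cases u; cases v) (auto simp: V simp del: seg.simps)
  qed
  with disj show ?thesis
    unfolding bipartite_def pverts_code_graph V image_Un
    by (intro exI[of _ ?A] exI[of _ ?B]) (simp add: subset_iff)
qed

section \<open>Counting\<close>

text \<open>
  For \<open>n \<ge> 49\<close> both \<open>n div 6 \<ge> n / 7\<close> and \<open>n / 7 \<ge> sqrt n\<close>, so the right-hand side is at least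
  \<open>sqrt n powr (n / 7) = n powr (n / 14)\<close>.
\<close>

lemma power_self_lower_bound:
  fixes n :: nat
  assumes "49 \<le> n"
  shows "2 powr (1 / 14 * real n * log 2 (real n)) \<le> real ((n div 6) ^ (n div 6))"
proof -
  let ?k = "n div 6"
  have k: "real n / 7 \<le> real ?k" "1 \<le> real ?k" using assms by linarith+
  have "2 powr (1 / 14 * real n * log 2 (real n)) = (2 powr log 2 (real n)) powr (real n / 14)"
    by (simp add: powr_powr mult.commute)
  also have "\<dots> = (real n powr (1 / 2)) powr (real n / 7)"
    using assms by (simp add: powr_powr)
  also have "\<dots> \<le> real ?k powr (real n / 7)"
  proof (rule powr_mono2)
    have "7 \<le> sqrt (real n)" using assms by (simp add: real_le_rsqrt)
    then have "7 * sqrt (real n) \<le> sqrt (real n) * sqrt (real n)" by (intro mult_right_mono) auto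
    then show "real n powr (1 / 2) \<le> real ?k" using k by (simp add: powr_half_sqrt)
  qed auto
  also have "\<dots> \<le> real ?k powr real ?k" using k by (intro powr_mono) auto
  also have "\<dots> = real (?k ^ ?k)" using k by (simp add: powr_realpow)
  finally show ?thesis .
qed

theorem mainTheorem7:
  shows "\<exists>c::real. c > 0 \<and>
    (\<forall>\<^sub>F n::nat in sequentially.
      \<exists>F :: (real ^ 2) set pair_pre_digraph set.
        (\<forall>G\<in>F. segment_graph G \<and> bipartite G \<and> card (pverts G) = n) \<and>
        pairwise (\<lambda>G H. \<not> isomorphic G H) F \<and>
        finite F \<and>
        real (card F) \<ge> 2 powr (c * real n * log 2 (real n)))"
proof (intro exI[of _ "1 / 14"] conjI eventually_sequentiallyI[of 49])
  fix n :: nat assume n: "49 \<le> n"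
  \<comment> \<open>Since \<open>2 * k < L\<close> amounts to \<open>5 * k + 3 \<le> n\<close>, a sixth of \<open>n\<close> is a safe choice for \<open>k\<close>.\<close>
  define k where "k = n div 6"
  define L where "L = n - 3 * k - 2"
  let ?F = "code_graph L k ` codes k"
  have k: "1 \<le> k" and L: "2 * k < L" and size: "L + 3 * k + 2 = n"
    using n by (auto simp: k_def L_def)
  have "inj_on (code_graph L k) (codes k)"
    by (rule inj_onI)
      (metis code_graph_isomorphic_imp_eq[OF L k] isomorphic_refl pair_graph_code_graph)
  then have "card ?F = k ^ k" by (simp add: card_image card_PiE)
  then have "2 powr (1 / 14 * real n * log 2 (real n)) \<le> real (card ?F)"
    using power_self_lower_bound[OF n] by (simp add: k_def)
  moreover have "\<forall>G\<in>?F. segment_graph G \<and> bipartite G \<and> card (pverts G) = n"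
  proof
    fix G assume "G \<in> ?F"
    then obtain g where g: "g \<in> codes k" "G = code_graph L k g" by blast
    have "card (pverts G) = n"
      unfolding g(2) pverts_code_graph card_image[OF inj_seg[OF k g(1)]] card_lines by (rule size)
    then show "segment_graph G \<and> bipartite G \<and> card (pverts G) = n"
      using segment_graph_code_graph[OF k g(1)] bipartite_code_graph[OF k g(1)] g(2) by simp
  qed
  moreover have "pairwise (\<lambda>G H. \<not> isomorphic G H) ?F"
    using code_graph_isomorphic_imp_eq[OF L k] unfolding pairwise_def by blast
  moreover have "finite ?F" by (simp add: finite_PiE)
  ultimately
  show "\<exists>F :: (real ^ 2) set pair_pre_digraph set.
        (\<forall>G\<in>F. segment_graph G \<and> bipartite G \<and> card (pverts G) = n) \<and>
        pairwise (\<lambda>G H. \<not> isomorphic G H) F \<and>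
        finite F \<and>
        real (card F) \<ge> 2 powr (1 / 14 * real n * log 2 (real n))"
    by (intro exI[of _ ?F] conjI)
qed simp

end
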